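(* Let $\Delta\subseteq\mathbb{R}^2$ be the Sierpiński triangle of side length one. Assume that $f:\Delta\to\mathbb{R}$ is a 1-Hölder-$\alpha$ function for some $0<\alpha\leq 1$. Then for Lebesgue almost every $r\in f(\Delta)$ we have $$\dim_H(f^{-1}(r))\geq \frac{\frac{\alpha}{2}}{1+\frac{1+\log\frac{3}{\alpha}}{\log 2}+\frac{2}{\alpha}}> 0.$$
   Context: $\Delta$ is the Sierpiński triangle obtained by starting with a (filled, closed) equilateral triangle $\Delta_0\subseteq\mathbb{R}^2$ of side length one: $\Delta=\bigcap_{n=0}^\infty\Delta_n$, where $\Delta_n$ is the union of the $3^n$ closed equilateral triangles of side length $2^{-n}$ appearing at the $n$th step of the standard construction (each triangle is replaced by the three corner triangles of half its size). A function $f:F\to\mathbb{R}$ on $F\subseteq\mathbb{R}^p$ is $c$-Hölder-$\alpha$ ($c>0$, $0<\alpha\le 1$) if $|f(x)-f(y)|\le c|x-y|^\alpha$ for all $x,y\in F$, where $|\cdot|$ is the Euclidean norm. $\dim_H$ denotes Hausdorff dimension and $\log$ is the natural logarithm. *)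

theory Defs
  imports "HOL-Analysis.Analysis"
begin

section \<open>Hausdorff measure and dimension\<close>

text \<open>
  The value \<open>(diam U)\<^sup>s\<close> with the usual conventions: the empty set contributes \<open>0\<close>, and for
  \<open>s = 0\<close> every nonempty set contributes \<open>1\<close>. The case distinction is needed because
  \<open>0 powr 0 = 0\<close> in the library.
\<close>

definition hausdorff_gauge :: "real \<Rightarrow> 'a::metric_space set \<Rightarrow> real" where
  "hausdorff_gauge s U =
     (if U = {} then 0 else if s = 0 then 1 else diameter U powr s)"

text \<open>
  Boundedness is required explicitly because \<^const>\<open>diameter\<close> is an unspecified real number on
  unbounded sets. Finite covers are included, as the sets \<open>U i\<close> may be empty.
\<close>

definition hausdorff_premeasure :: "real \<Rightarrow> real \<Rightarrow> 'a::metric_space set \<Rightarrow> ennreal" where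
  "hausdorff_premeasure s \<delta> A =
     (INF U \<in> {U :: nat \<Rightarrow> 'a set.
                 A \<subseteq> (\<Union>i. U i) \<and> (\<forall>i. bounded (U i) \<and> diameter (U i) \<le> \<delta>)}.
        \<Sum>i. ennreal (hausdorff_gauge s (U i)))"

definition hausdorff_measure :: "real \<Rightarrow> 'a::metric_space set \<Rightarrow> ennreal" where
  "hausdorff_measure s A = (SUP \<delta> \<in> {0<..}. hausdorff_premeasure s \<delta> A)"

definition hausdorff_dim :: "'a::metric_space set \<Rightarrow> ereal" where
  "hausdorff_dim A = Inf {ereal s | s. 0 \<le> s \<and> hausdorff_measure s A = 0}"

section \<open>The Sierpinski triangle\<close>

text \<open>A triangle is represented by the triple of its vertices.\<close>

primrec sierpinski_pieces :: "'a::real_vector \<times> 'a \<times> 'a \<Rightarrow> nat \<Rightarrow> ('a \<times> 'a \<times> 'a) set" where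
  "sierpinski_pieces t 0 = {t}"
| "sierpinski_pieces t (Suc n) =
     (\<Union>(a, b, c) \<in> sierpinski_pieces t n.
        {(a, midpoint a b, midpoint a c),
         (midpoint a b, b, midpoint b c),
         (midpoint a c, midpoint b c, c)})"

definition sierpinski_step :: "'a::real_vector \<times> 'a \<times> 'a \<Rightarrow> nat \<Rightarrow> 'a set" where
  "sierpinski_step t n = (\<Union>(a, b, c) \<in> sierpinski_pieces t n. convex hull {a, b, c})"

definition sierpinski :: "'a::real_vector \<times> 'a \<times> 'a \<Rightarrow> 'a set" where
  "sierpinski t = (\<Inter>n. sierpinski_step t n)"

section \<open>Hoelder functions\<close>

definition holder_on :: "real \<Rightarrow> real \<Rightarrow> 'a::real_normed_vector set \<Rightarrow> ('a \<Rightarrow> real) \<Rightarrow> bool" where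
  "holder_on c \<alpha> F f \<longleftrightarrow>
     0 < c \<and> 0 < \<alpha> \<and> \<alpha> \<le> 1 \<and>
     (\<forall>x\<in>F. \<forall>y\<in>F. \<bar>f x - f y\<bar> \<le> c * norm (x - y) powr \<alpha>)"

end

theory Submission
  imports Defs
begin

text \<open>
  Fix a level \<open>y\<close> and label every vertex \<open>v\<close> of every triangle of the construction by whether
  \<open>f v < y\<close>. A triangle is mixed if it carries both labels; one of its vertices is then isolated, its
  label differing from the other two. By continuity, a nested sequence of mixed triangles
  shrinks to a point of \<open>f\<^sup>-\<^sup>1(y)\<close>, so the level set contains the boundary of the tree of words all of whose
  ancestors are mixed (the alive words), and it is enough to show that this tree is thick.

  The combinatorial heart is \<open>unforked_step\<close>: every mixed triangle has a mixed child, and if it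
  has only one, then that child is the corner at the isolated vertex and is isolated at the same
  vertex. Hence an alive word can be recovered from the times at which two or more children were
  mixed (the forks), together with one of nine choices made at each of these times and one initial
  choice; between forks the word has no freedom. So there are at most
  \<open>3 (1 + 9 t)\<^sup>n t\<^sup>-\<^sup>\<theta>\<^sup>n\<close> candidates for an alive word of length \<open>n\<close> with at most \<open>\<theta> n\<close> forks
  (\<open>card_few_jumps_le\<close>), whatever \<open>y\<close> is.

  A triangle of side \<open>2\<^sup>-\<^sup>n\<close> is mixed only for \<open>y\<close> in an interval of length at most
  \<open>2 * 2\<^sup>-\<^sup>\<alpha>\<^sup>n\<close>. If \<open>(1 + 9 t) t\<^sup>-\<^sup>\<theta> < 2\<^sup>\<alpha>\<close>, these intervals over all candidates have summable total length,
  and by Borel-Cantelli almost every \<open>y\<close> has the property that all long alive words of length \<open>n\<close>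
  contain at least \<open>\<theta> n\<close> forks (\<open>AE_fork_growth\<close>). The value of \<open>\<theta>\<close> in the theorem satisfies the inequality with
  \<open>t = \<theta> / 9\<close> (\<open>exponent_inequality\<close>).

  Give an alive word with \<open>k\<close> forks the weight \<open>2\<^sup>-\<^sup>k\<close>. As each fork has at least two alive
  children, any finite set of words that cuts the tree has total weight at least \<open>1\<close>
  (\<open>cut_weight_ge\<close>), while a word of length \<open>n\<close> has weight at most a constant times
  \<open>(2\<^sup>-\<^sup>n)\<^sup>\<theta>\<close>. A set of diameter about \<open>2\<^sup>-\<^sup>n\<close> meets boundedly many triangles of level \<open>n\<close>
  (\<open>bounded_overlap\<close>), so the mass distribution principle bounds the \<open>s\<close>-dimensional Hausdorff
  measure of the level set away from \<open>0\<close> for \<open>s \<le> \<theta>\<close> (\<open>level_set_measure_pos\<close>).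

  The tree need not be rooted at the whole triangle, whose three vertices may
  all carry the same label. But unless \<open>y\<close> is the maximum or minimum of \<open>f\<close>, some triangle of some level
  is mixed (\<open>obtain_mixed_triangle\<close>), and there are only countably many roots to consider.
\<close>

section \<open>Mixed triangles and their children\<close>

text \<open>
  The corner \<open>c\<close> keeps its position \<open>c\<close> in the child, as the midpoint of \<open>T c\<close> with itself.
\<close>

definition child :: "(3 \<Rightarrow> 'a::real_vector) \<Rightarrow> 3 \<Rightarrow> 3 \<Rightarrow> 'a" where
  "child T c = (\<lambda>i. midpoint (T c) (T i))"

text \<open>
  Words are read backwards: the head of the list is the child chosen last, so that the descendants
  of \<open>w\<close> are the words with suffix \<open>w\<close>.
\<close>

primrec vtx :: "(3 \<Rightarrow> 'a::real_vector) \<Rightarrow> 3 list \<Rightarrow> 3 \<Rightarrow> 'a" where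
  "vtx P [] = P"
| "vtx P (c # w) = child (vtx P w) c"

definition mixed :: "('a \<Rightarrow> bool) \<Rightarrow> (3 \<Rightarrow> 'a) \<Rightarrow> bool" where
  "mixed L T \<longleftrightarrow> (\<exists>i j. L (T i) \<noteq> L (T j))"

definition isolated :: "('a \<Rightarrow> bool) \<Rightarrow> (3 \<Rightarrow> 'a) \<Rightarrow> 3 \<Rightarrow> bool" where
  "isolated L T s \<longleftrightarrow> (\<forall>i. i \<noteq> s \<longrightarrow> L (T i) \<noteq> L (T s))"

definition forks :: "('a::real_vector \<Rightarrow> bool) \<Rightarrow> (3 \<Rightarrow> 'a) \<Rightarrow> bool" where
  "forks L T \<longleftrightarrow> (\<exists>c d. c \<noteq> d \<and> mixed L (child T c) \<and> mixed L (child T d))"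

text \<open>
  All ancestors are required to be mixed: the parent of a mixed triangle may carry a
  single label, the other one appearing only at a midpoint.
\<close>

primrec alive :: "('a::real_vector \<Rightarrow> bool) \<Rightarrow> (3 \<Rightarrow> 'a) \<Rightarrow> 3 list \<Rightarrow> bool" where
  "alive L P [] = mixed L P"
| "alive L P (c # w) = (alive L P w \<and> mixed L (vtx P (c # w)))"

primrec fork_count :: "('a::real_vector \<Rightarrow> bool) \<Rightarrow> (3 \<Rightarrow> 'a) \<Rightarrow> 3 list \<Rightarrow> nat" where
  "fork_count L P [] = 0"
| "fork_count L P (c # w) = fork_count L P w + of_bool (forks L (vtx P w))"

lemma alive_imp_mixed: "alive L P w \<Longrightarrow> mixed L (vtx P w)"
  by (cases w) auto

lemma alive_append: "alive L P (u @ w) \<Longrightarrow> alive L P w"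
  by (induction u) auto

lemma vtx_append: "vtx P (u @ w) = vtx (vtx P w) u"
  by (induction u) auto

lemma vtx_diff: "vtx P w i - vtx P w j = (1 / 2 ^ length w) *\<^sub>R (P i - P j)"
proof (induction w)
  case (Cons c w)
  have "vtx P (c # w) i - vtx P (c # w) j = (1/2) *\<^sub>R (vtx P w i - vtx P w j)"
    by (simp add: child_def midpoint_def algebra_simps)
  then show ?case using Cons by simp
qed simp

lemma exists_3: "(\<exists>i::3. P i) \<longleftrightarrow> P 1 \<or> P 2 \<or> P 3"
  by (metis exhaust_3)

lemma mixed_obtain_isolated:
  assumes "mixed L T"
  obtains s where "isolated L T s"
proof -
  have "\<exists>s. isolated L T s"
    using assms unfolding mixed_def isolated_def exists_3 forall_3 by auto
  then show thesis using that by blast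
qed

lemma isolated_unique:
  assumes "isolated L T s" "isolated L T s'"
  shows "s = s'"
  using assms exhaust_3[of s] exhaust_3[of s'] unfolding isolated_def forall_3 by auto

lemma mixed_imp_mixed_child:
  assumes "mixed L T"
  obtains c where "mixed L (child T c)"
proof -
  obtain i j where ij: "L (T i) \<noteq> L (T j)" using assms mixed_def by blast
  have "child T i i = T i" "child T j j = T j" "child T i j = child T j i"
    by (simp_all add: child_def midpoint_sym)
  then have "mixed L (child T i) \<or> mixed L (child T j)"
    using ij unfolding mixed_def by metis
  then show thesis using that by blast
qed

text \<open>
  Two children share the midpoint of the edge between their corners. If \<open>c\<close> is the only mixed
  child, every other child carries the single label of its own corner, hence so do the midpoints
  that it shares. For \<open>c \<noteq> s\<close> the two other corners \<open>s\<close> and \<open>d\<close> would thus have equal labels through their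
  common midpoint, against isolation; for \<open>c = s\<close> the other two vertices of the child, which are
  the midpoints shared with the other two children, carry the labels of the corners of these.
\<close>

lemma unforked_step:
  assumes iso: "isolated L T s" and mx: "mixed L (child T c)" and nf: "\<not> forks L T"
  shows "c = s" "isolated L (child T s) s"
proof -
  have un: "L (child T d i) = L (T d)" if "d \<noteq> c" for d i
  proof -
    have "\<not> mixed L (child T d)" using nf mx that unfolding forks_def by blast
    moreover have "child T d d = T d" by (simp add: child_def)
    ultimately show ?thesis unfolding mixed_def by metis
  qed
  have cen: "child T d d = T d" for d by (simp add: child_def)
  have sym: "child T i j = child T j i" for i j by (simp add: child_def midpoint_sym)
  show cs: "c = s"
  proof (rule ccontr)
    assume cs: "c \<noteq> s"
    have "\<not> UNIV \<subseteq> {s, c}"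
    proof
      assume "UNIV \<subseteq> {s, c}"
      then have "card (UNIV :: 3 set) \<le> card {s, c}" by (intro card_mono) auto
      then show False using cs by simp
    qed
    then obtain d where d: "d \<noteq> s" "d \<noteq> c" by blast
    have "L (T d) = L (T s)" using un[of d s] un[of s d] d cs sym[of d s] by metis
    then show False using iso d unfolding isolated_def by blast
  qed
  show "isolated L (child T s) s" unfolding isolated_def
  proof (intro allI impI)
    fix i assume "i \<noteq> s"
    then show "L (child T s i) \<noteq> L (child T s s)"
      using un[of i s] cs sym[of i s] iso cen[of s] by (metis isolated_def)
  qed
qed

section \<open>Counting words with few forks\<close>

text \<open>
  The decoder carries the word and the current isolated corner. \<^term>\<open>None\<close> stands for an
  unforked step, which \<open>unforked_step\<close> determines; \<^term>\<open>Some (c, s)\<close> stands for a fork after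
  which the walk goes on in the child \<open>c\<close>, isolated at \<open>s\<close>.
\<close>

primrec decode :: "3 \<Rightarrow> (3 \<times> 3) option list \<Rightarrow> 3 list \<times> 3" where
  "decode s [] = ([], s)"
| "decode s (x # xs) =
     (case decode s xs of (w, s') \<Rightarrow>
        (case x of None \<Rightarrow> (s' # w, s') | Some (c, s'') \<Rightarrow> (c # w, s'')))"

definition jumps :: "'b option list \<Rightarrow> nat" where
  "jumps xs = length (filter (\<lambda>x. x \<noteq> None) xs)"

lemma jumps_Cons: "jumps (x # xs) = (if x = None then 0 else 1) + jumps xs"
  by (simp add: jumps_def)

lemma alive_has_code:
  assumes "alive L P w" "isolated L (vtx P w) s"
  shows "\<exists>s0 xs. length xs = length w \<and> jumps xs = fork_count L P w \<and> decode s0 xs = (w, s)"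
  using assms
proof (induction w arbitrary: s)
  case Nil
  then show ?case by (auto intro!: exI[of _ s] simp: jumps_def)
next
  case (Cons c w)
  have aw: "alive L P w" and mc: "mixed L (child (vtx P w) c)" using Cons.prems by auto
  obtain s' where s': "isolated L (vtx P w) s'"
    using mixed_obtain_isolated[OF alive_imp_mixed[OF aw]] by blast
  obtain s0 xs where xs: "length xs = length w" "jumps xs = fork_count L P w"
      "decode s0 xs = (w, s')" using Cons.IH[OF aw s'] by blast
  show ?case
  proof (cases "forks L (vtx P w)")
    case True
    then show ?thesis using xs
      by (intro exI[of _ s0] exI[of _ "Some (c, s) # xs"]) (auto simp: jumps_def)
  next
    case False
    have "c = s'" "isolated L (child (vtx P w) s') s'" using unforked_step[OF s' mc False] by auto
    moreover have "s = s'" using Cons.prems calculation isolated_unique by fastforce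
    ultimately show ?thesis using xs False
      by (intro exI[of _ s0] exI[of _ "None # xs"]) (auto simp: jumps_def)
  qed
qed

lemma finite_lists_length: "finite {xs :: 'b::finite list. length xs = n}"
  using finite_lists_length_eq[of "UNIV :: 'b set" n] by simp

text \<open>
  A generating function in place of binomial coefficients: each position contributes \<open>1\<close> for
  \<^term>\<open>None\<close> and \<open>t\<close> for each of the nine other letters.
\<close>

lemma sum_power_jumps:
  fixes t :: real
  shows "(\<Sum>xs | length (xs :: (3 \<times> 3) option list) = n. t ^ jumps xs) = (1 + 9 * t) ^ n"
proof (induction n)
  case 0
  show ?case by (simp add: jumps_def)
next
  case (Suc n)
  let ?S = "{xs :: (3 \<times> 3) option list. length xs = n}"
  have eq: "{xs :: (3 \<times> 3) option list. length xs = Suc n} = (\<lambda>(x, xs). x # xs) ` (UNIV \<times> ?S)"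
    by (auto simp: length_Suc_conv image_iff)
  have one: "(\<Sum>x\<in>(UNIV :: (3 \<times> 3) option set). t ^ (if x = None then 0 else 1)) = 1 + 9 * t"
    by (simp add: UNIV_option_conv sum.reindex)
  have "(\<Sum>xs | length (xs :: (3 \<times> 3) option list) = Suc n. t ^ jumps xs)
      = (\<Sum>(x, xs)\<in>UNIV \<times> ?S. t ^ jumps (x # xs))"
    unfolding eq by (subst sum.reindex) (auto simp: inj_on_def intro!: sum.cong)
  also have "\<dots> = (\<Sum>x\<in>(UNIV :: (3 \<times> 3) option set). \<Sum>xs\<in>?S. t ^ (if x = None then 0 else 1) * t ^ jumps xs)"
    by (subst sum.cartesian_product[symmetric]) (simp add: jumps_Cons power_add)
  also have "\<dots> = (1 + 9 * t) * (1 + 9 * t) ^ n"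
    unfolding sum_distrib_left[symmetric] sum_distrib_right[symmetric] Suc one ..
  finally show ?case by simp
qed

text \<open>
  Chernoff's argument: for \<open>t \<le> 1\<close> a code with at most \<open>\<theta> n\<close> jumps contributes at least
  \<open>t powr (\<theta> n)\<close> to the generating function.
\<close>

lemma card_few_jumps_le:
  fixes t \<theta> :: real
  assumes t: "0 < t" "t \<le> 1"
  shows "card {xs :: (3 \<times> 3) option list. length xs = n \<and> real (jumps xs) \<le> \<theta> * n}
           \<le> ((1 + 9 * t) * t powr (- \<theta>)) ^ n"
proof -
  let ?G = "{xs :: (3 \<times> 3) option list. length xs = n \<and> real (jumps xs) \<le> \<theta> * n}"
  have "real (card ?G) * t powr (\<theta> * n) = (\<Sum>xs\<in>?G. t powr (\<theta> * n))" by simp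
  also have "\<dots> \<le> (\<Sum>xs\<in>?G. t ^ jumps xs)"
    using t by (intro sum_mono) (auto simp: powr_realpow[symmetric] intro!: powr_mono')
  also have "\<dots> \<le> (\<Sum>xs | length (xs :: (3 \<times> 3) option list) = n. t ^ jumps xs)"
    using t by (intro sum_mono2 finite_lists_length) auto
  also have "\<dots> = (1 + 9 * t) ^ n" by (rule sum_power_jumps)
  finally have "real (card ?G) \<le> (1 + 9 * t) ^ n / t powr (\<theta> * n)"
    using t by (simp add: field_simps)
  also have "\<dots> = ((1 + 9 * t) * t powr (- \<theta>)) ^ n"
    using t by (simp add: powr_minus power_mult_distrib field_simps powr_power)
  finally show ?thesis .
qed

section \<open>The weight of a cut of the tree\<close>

definition descendants :: "3 list \<Rightarrow> 3 list set" where
  "descendants w = {x. \<exists>u. x = u @ w}"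

lemma descendants_Cons_subset: "descendants (c # w) \<subseteq> descendants w"
  unfolding descendants_def by (auto intro: exI[of _ "_ @ [c]"])

lemma descendants_Cons_disjoint: "c \<noteq> d \<Longrightarrow> descendants (c # w) \<inter> descendants (d # w) = {}"
proof -
  assume cd: "c \<noteq> d"
  have False if "u @ c # w = u' @ d # w" for u u'
  proof -
    have "(u @ [c]) @ w = (u' @ [d]) @ w" using that by simp
    then have "u @ [c] = u' @ [d]" unfolding append_same_eq .
    then show False using cd by simp
  qed
  then show ?thesis unfolding descendants_def by blast
qed

lemma descendants_linear:
  assumes "x \<in> descendants v" "x \<in> descendants w" "length v \<le> length w"
  shows "w \<in> descendants v"
proof -
  obtain a b where "x = a @ v" "x = b @ w" using assms unfolding descendants_def by blast
  then have "a @ v = b @ w" by simp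
  then show ?thesis using assms(3)
    unfolding descendants_def by (auto simp: append_eq_append_conv2)
qed

text \<open>
  Induction from level \<open>n\<close> upwards. The weight of a word is at most the total weight of its alive
  children: at a fork there are at least two, each of half the weight, and otherwise there is one
  of the same weight.
\<close>

lemma cut_weight_ge:
  assumes fin: "finite F" and F: "\<And>u. u \<in> F \<Longrightarrow> alive L P u"
    and cut: "\<And>x. alive L P x \<Longrightarrow> length x = n \<Longrightarrow> x \<in> descendants w \<Longrightarrow> \<exists>u\<in>F. u \<in> descendants w \<and> x \<in> descendants u"
    and w: "alive L P w" "length w + k = n"
  shows "(1/2) ^ fork_count L P w \<le> (\<Sum>u\<in>F \<inter> descendants w. (1/2::real) ^ fork_count L P u)"
  using cut w
proof (induction k arbitrary: w)
  case 0
  then obtain u where u: "u \<in> F" "u \<in> descendants w" "w \<in> descendants u"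
    using 0(1)[of w] by (auto simp: descendants_def)
  then have "u = w" by (auto simp: descendants_def)
  then show ?case using u fin
    by (intro member_le_sum[where f = "\<lambda>u. (1/2::real) ^ fork_count L P u"]) auto
next
  case (Suc k)
  let ?S = "\<lambda>w. \<Sum>u\<in>F \<inter> descendants w. (1/2::real) ^ fork_count L P u"
  show ?case
  proof (cases "w \<in> F")
    case True
    then show ?thesis using fin
      by (intro member_le_sum[where f = "\<lambda>u. (1/2::real) ^ fork_count L P u"])
         (auto simp: descendants_def)
  next
    case False
    have child: "(1/2) ^ fork_count L P (c # w) \<le> ?S (c # w)"
      if c: "mixed L (child (vtx P w) c)" for c
    proof (rule Suc.IH)
      show "alive L P (c # w)" using Suc.prems c by simp
      show "length (c # w) + k = n" using Suc.prems by simp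
      fix x assume x: "alive L P x" "length x = n" "x \<in> descendants (c # w)"
      then obtain u where u: "u \<in> F" "u \<in> descendants w" "x \<in> descendants u"
        using Suc.prems(1)[OF x(1,2)] descendants_Cons_subset by blast
      have "u \<noteq> w" using u False by blast
      then have "length (c # w) \<le> length u" using u unfolding descendants_def
        by (auto simp: Suc_le_eq)
      then show "\<exists>u\<in>F. u \<in> descendants (c # w) \<and> x \<in> descendants u"
        using descendants_linear[OF x(3) u(3)] u by blast
    qed
    show ?thesis
    proof (cases "forks L (vtx P w)")
      case True
      then obtain c d where cd: "c \<noteq> d" "mixed L (child (vtx P w) c)" "mixed L (child (vtx P w) d)"
        unfolding forks_def by blast
      have "(1/2) ^ fork_count L P w = (1/2::real) ^ fork_count L P (c # w) + (1/2) ^ fork_count L P (d # w)"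
        using True by simp
      also have "\<dots> \<le> ?S (c # w) + ?S (d # w)" using child cd by (intro add_mono) auto
      also have "\<dots> = (\<Sum>u\<in>(F \<inter> descendants (c # w)) \<union> (F \<inter> descendants (d # w)). (1/2::real) ^ fork_count L P u)"
        using fin descendants_Cons_disjoint[OF cd(1), of w] by (subst sum.union_disjoint) auto
      also have "\<dots> \<le> ?S w" using fin descendants_Cons_subset by (intro sum_mono2) auto
      finally show ?thesis .
    next
      case False
      obtain c where c: "mixed L (child (vtx P w) c)"
        using mixed_imp_mixed_child[OF alive_imp_mixed[OF Suc.prems(2)]] by blast
      have "(1/2) ^ fork_count L P w = (1/2::real) ^ fork_count L P (c # w)" using False by simp
      also have "\<dots> \<le> ?S (c # w)" by (rule child[OF c])
      also have "\<dots> \<le> ?S w" using fin descendants_Cons_subset by (intro sum_mono2) auto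
      finally show ?thesis .
    qed
  qed
qed

section \<open>Triangles of one level near a point\<close>

text \<open>
  The numbers \<open>address 2 w\<close> and \<open>address 3 w\<close> are the lattice coordinates of the first vertex of the
  triangle \<open>w\<close> with respect to the two edges at vertex \<open>1\<close>, in units of \<open>2\<^sup>-\<^sup>n\<close> for \<open>n = length w\<close>.
\<close>

primrec address :: "3 \<Rightarrow> 3 list \<Rightarrow> nat" where
  "address e [] = 0"
| "address e (c # w) = 2 * address e w + of_bool (c = e)"

lemma address_inj:
  assumes "length v = length w" "address 2 v = address 2 w" "address 3 v = address 3 w"
  shows "v = w"
  using assms
proof (induction v w rule: list_induct2)
  case (Cons c v d w)
  have 1: "(c = e) = (d = e)" "address e v = address e w" if "e = 2 \<or> e = 3" for e
  proof -
    have eq: "2 * address e v + of_bool (c = e) = 2 * address e w + of_bool (d = e)"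
      using Cons.prems that by auto
    then have "odd (2 * address e v + of_bool (c = e)) = odd (2 * address e w + of_bool (d = e))"
      by (rule arg_cong)
    then show ce: "(c = e) = (d = e)" by simp
    show "address e v = address e w" using eq unfolding ce by simp
  qed
  have "c = d" using 1(1)[of 2] 1(1)[of 3] exhaust_3[of c] exhaust_3[of d] by auto
  then show ?case using 1(2) Cons.IH by simp
qed simp

lemma vtx_first:
  "vtx P w 1 = P 1 + (1 / 2 ^ length w) *\<^sub>R
     (real (address 2 w) *\<^sub>R (P 2 - P 1) + real (address 3 w) *\<^sub>R (P 3 - P 1))"
proof (induction w)
  case (Cons c w)
  have "vtx P (c # w) 1 = vtx P w 1 + (1/2) *\<^sub>R (vtx P w c - vtx P w 1)"
    by (simp add: child_def midpoint_def algebra_simps flip: scaleR_add_left)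
  also have "\<dots> = P 1 + (1 / 2 ^ length w) *\<^sub>R
     (real (address 2 w) *\<^sub>R (P 2 - P 1) + real (address 3 w) *\<^sub>R (P 3 - P 1))
       + (1 / 2 ^ length (c # w)) *\<^sub>R (P c - P 1)"
    by (subst vtx_diff, subst Cons) simp
  also have "\<dots> = P 1 + (1 / 2 ^ length (c # w)) *\<^sub>R
     (real (address 2 (c # w)) *\<^sub>R (P 2 - P 1) + real (address 3 (c # w)) *\<^sub>R (P 3 - P 1))"
    using exhaust_3[of c] by (auto simp: algebra_simps)
  finally show ?case .
qed simp

text \<open>
  A quantitative form of the linear independence of the two edges at vertex \<open>1\<close>.
\<close>

definition nondegenerate :: "(3 \<Rightarrow> 'a::real_normed_vector) \<Rightarrow> bool" where
  "nondegenerate P \<longleftrightarrow> (\<exists>\<Lambda>. \<forall>a b. \<bar>a\<bar> + \<bar>b\<bar> \<le> \<Lambda> * norm (a *\<^sub>R (P 2 - P 1) + b *\<^sub>R (P 3 - P 1)))"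

lemma nondegenerate_vtx: "nondegenerate P \<Longrightarrow> nondegenerate (vtx P w)"
proof -
  assume "nondegenerate P"
  then obtain \<Lambda> where \<Lambda>: "\<bar>a\<bar> + \<bar>b\<bar> \<le> \<Lambda> * norm (a *\<^sub>R (P 2 - P 1) + b *\<^sub>R (P 3 - P 1))" for a b
    unfolding nondegenerate_def by blast
  have "\<bar>a\<bar> + \<bar>b\<bar> \<le> (\<Lambda> * 2 ^ length w) * norm (a *\<^sub>R (vtx P w 2 - vtx P w 1) + b *\<^sub>R (vtx P w 3 - vtx P w 1))" for a b
  proof -
    have "a *\<^sub>R (vtx P w 2 - vtx P w 1) + b *\<^sub>R (vtx P w 3 - vtx P w 1)
       = (1 / 2 ^ length w) *\<^sub>R (a *\<^sub>R (P 2 - P 1) + b *\<^sub>R (P 3 - P 1))"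
      by (subst (1 2) vtx_diff) (simp add: algebra_simps)
    then show ?thesis using \<Lambda>[of a b] by simp
  qed
  then show ?thesis unfolding nondegenerate_def by blast
qed

text \<open>
  The first vertices of distinct words of length \<open>n\<close> are distinct points of a lattice of mesh \<open>2\<^sup>-\<^sup>n\<close>,
  of which a ball of radius \<open>3 / 2\<^sup>n\<close> contains a number bounded independently of \<open>n\<close>.
\<close>

lemma bounded_overlap:
  assumes "nondegenerate P"
  obtains M :: nat where "\<And>n x. finite {w. length w = n \<and> dist (vtx P w 1) x < 3 / 2 ^ n}"
    "\<And>n x. card {w. length w = n \<and> dist (vtx P w 1) x < 3 / 2 ^ n} \<le> M"
proof -
  obtain \<Lambda> where \<Lambda>: "\<bar>a\<bar> + \<bar>b\<bar> \<le> \<Lambda> * norm (a *\<^sub>R (P 2 - P 1) + b *\<^sub>R (P 3 - P 1))" for a b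
    using assms unfolding nondegenerate_def by blast
  have \<Lambda>0: "\<Lambda> \<ge> 0"
  proof (rule ccontr)
    assume "\<not> \<Lambda> \<ge> 0"
    then have "\<Lambda> * norm (1 *\<^sub>R (P 2 - P 1) + 1 *\<^sub>R (P 3 - P 1)) \<le> 0"
      by (intro mult_nonpos_nonneg) auto
    then show False using \<Lambda>[of 1 1] by simp
  qed
  define N where "N = \<lceil>6 * \<Lambda>\<rceil>"
  define M where "M = card ({-N..N} \<times> {-N..N})"
  have fin: "finite {w :: 3 list. length w = n \<and> dist (vtx P w 1) x < 3 / 2 ^ n}" for n x
    using finite_lists_length[where 'b = 3, of n] by (rule rev_finite_subset) auto
  have "card {w. length w = n \<and> dist (vtx P w 1) x < 3 / 2 ^ n} \<le> M" for n x
  proof (cases "{w. length w = n \<and> dist (vtx P w 1) x < 3 / 2 ^ n} = {}")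
    case False
    let ?W = "{w. length w = n \<and> dist (vtx P w 1) x < 3 / 2 ^ n}"
    from False obtain v where v: "v \<in> ?W" by blast
    let ?g = "\<lambda>w. (int (address 2 w) - int (address 2 v), int (address 3 w) - int (address 3 v))"
    have "inj_on ?g ?W" by (rule inj_onI) (auto intro!: address_inj)
    moreover have "?g ` ?W \<subseteq> {-N..N} \<times> {-N..N}"
    proof (rule image_subsetI)
      fix w assume w: "w \<in> ?W"
      let ?a = "real (address 2 w) - real (address 2 v)" and ?b = "real (address 3 w) - real (address 3 v)"
      have "(1 / 2 ^ n) *\<^sub>R (?a *\<^sub>R (P 2 - P 1) + ?b *\<^sub>R (P 3 - P 1)) = vtx P w 1 - vtx P v 1"
        using v w by (simp add: vtx_first[of P w] vtx_first[of P v] algebra_simps)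
      moreover have "norm (vtx P w 1 - vtx P v 1) < 6 / 2 ^ n"
        using v w dist_triangle2[of "vtx P w 1" "vtx P v 1" x] by (simp add: dist_norm)
      ultimately have "norm (?a *\<^sub>R (P 2 - P 1) + ?b *\<^sub>R (P 3 - P 1)) / 2 ^ n < 6 / 2 ^ n"
        by (metis (no_types, lifting) norm_scaleR abs_divide abs_one power_abs abs_numeral
            mult_1 times_divide_eq_left)
      then have "norm (?a *\<^sub>R (P 2 - P 1) + ?b *\<^sub>R (P 3 - P 1)) \<le> 6"
        by (simp add: divide_less_cancel)
      then have "\<bar>?a\<bar> + \<bar>?b\<bar> \<le> \<Lambda> * 6"
        using \<Lambda>[of ?a ?b] \<Lambda>0 by (meson mult_left_mono order_trans)
      then have "\<bar>?a\<bar> \<le> of_int N" "\<bar>?b\<bar> \<le> of_int N" unfolding N_def by linarith+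
      then show "?g w \<in> {-N..N} \<times> {-N..N}" by auto
    qed
    ultimately show ?thesis unfolding M_def
      using card_inj_on_le[of ?g ?W "{-N..N} \<times> {-N..N}"] by blast
  next
    case True
    show ?thesis unfolding True by simp
  qed
  with fin show thesis using that by blast
qed

section \<open>The Hausdorff measure of a level set\<close>

definition vertices :: "(3 \<Rightarrow> 'a::real_vector) \<Rightarrow> 'a set" where
  "vertices P = {vtx P w i | w i. True}"

lemma vtx_in_vertices: "vtx P w i \<in> vertices P"
  unfolding vertices_def by blast

lemma vtx_in_hull: "vtx P w i \<in> convex hull (range P)"
proof (induction w arbitrary: i)
  case (Cons c w)
  have "closed_segment (vtx P w c) (vtx P w i) \<subseteq> convex hull (range P)"
    using Cons by (intro closed_segment_subset) auto
  then show ?case using midpoint_in_closed_segment by (auto simp: child_def)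
qed (simp add: hull_inc)

lemma dist_vtx_hull:
  fixes P :: "3 \<Rightarrow> 'a::real_normed_vector"
  assumes diam: "\<And>i j. dist (P i) (P j) \<le> 1" and x: "x \<in> convex hull (range (vtx P w))"
  shows "dist x (vtx P w i) \<le> 1 / 2 ^ length w"
proof -
  have "dist (vtx P w j) (vtx P w i) \<le> 1 / 2 ^ length w" for j
    using diam[of j i] by (simp add: dist_norm vtx_diff divide_right_mono)
  then have "convex hull (range (vtx P w)) \<subseteq> cball (vtx P w i) (1 / 2 ^ length w)"
    by (intro hull_minimal) (auto simp: dist_commute)
  then show ?thesis using x by (auto simp: dist_commute)
qed

lemma compact_closure_vertices:
  fixes P :: "3 \<Rightarrow> 'a::euclidean_space"
  assumes diam: "\<And>i j. dist (P i) (P j) \<le> 1"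
  shows "compact (closure (vertices P))"
proof -
  have "dist (vtx P w i) (P 1) \<le> 1" for w i
    using dist_vtx_hull[of P "vtx P w i" "[]" 1, OF diam] vtx_in_hull[of P w i] by simp
  then have "vertices P \<subseteq> cball (P 1) 1" unfolding vertices_def by (auto simp: dist_commute)
  then show ?thesis by (meson bounded_cball bounded_subset compact_closure)
qed

text \<open>
  Replaces a covering set by a dyadic scale. The error \<open>\<epsilon>\<close> takes care of sets of
  diameter \<open>0\<close>, which have no scale of their own.
\<close>

lemma dyadic_scale:
  fixes d \<theta> \<epsilon> :: real
  assumes d: "0 \<le> d" "d \<le> 1" and "0 < \<theta>" "0 < \<epsilon>"
  shows "\<exists>n. d \<le> 1 / 2 ^ n \<and> (1 / 2 ^ n) powr \<theta> \<le> 2 powr \<theta> * d powr \<theta> + \<epsilon>"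
proof (cases "d = 0")
  case True
  have "(1/2::real) powr \<theta> < 1" using \<open>0 < \<theta>\<close> by (simp add: powr_def ln_div)
  then obtain n where "((1/2::real) powr \<theta>) ^ n < \<epsilon>"
    using real_arch_pow_inv[OF \<open>0 < \<epsilon>\<close>] by blast
  moreover have "(1 / 2 ^ n) powr \<theta> = ((1/2::real) powr \<theta>) ^ n"
  proof -
    have "1 / 2 ^ n = (1/2::real) powr real n" by (simp add: powr_realpow power_one_over)
    then show ?thesis by (simp add: powr_powr powr_power mult.commute)
  qed
  ultimately show ?thesis using True by (intro exI[of _ n]) auto
next
  case False
  then have "d > 0" using d by simp
  then obtain m where "(1/2::real) ^ m < d" using real_arch_pow_inv[of d "1/2"] by auto
  then have ex: "1 / 2 ^ m < d" by (simp add: power_one_over)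
  define k where "k = (LEAST n. 1 / 2 ^ n < d)"
  have k: "1 / 2 ^ k < d" unfolding k_def using ex by (rule LeastI)
  have "k \<noteq> 0" using k d by (cases "k = 0") auto
  then obtain n where n: "k = Suc n" using not0_implies_Suc by blast
  have dn: "d \<le> 1 / 2 ^ n" using not_less_Least[of n "\<lambda>n. 1 / 2 ^ n < d"] n
    unfolding k_def[symmetric] by auto
  have "(1 / 2 ^ n) \<le> 2 * d" using k n by simp
  then have "(1 / 2 ^ n) powr \<theta> \<le> (2 * d) powr \<theta>"
    using \<open>0 < \<theta>\<close> by (intro powr_mono2) auto
  also have "\<dots> = 2 powr \<theta> * d powr \<theta>" using d by (simp add: powr_mult)
  finally show ?thesis using dn \<open>0 < \<epsilon>\<close> by (intro exI[of _ n]) auto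
qed

lemma diameter_powr_le_gauge:
  assumes "U \<noteq> {}" "bounded U" "diameter U \<le> 1" "0 \<le> s" "s \<le> \<theta>"
  shows "diameter U powr \<theta> \<le> hausdorff_gauge s U"
  using assms powr_mono'[of s \<theta> "diameter U"] diameter_ge_0[of U]
  by (auto simp: hausdorff_gauge_def powr_le1)

lemma hausdorff_gauge_nonneg: "0 \<le> hausdorff_gauge s U"
  by (simp add: hausdorff_gauge_def)

lemma sum_UN_le:
  fixes g :: "'b \<Rightarrow> real"
  assumes "finite I" "\<And>i. finite (W i)" "\<And>x. 0 \<le> g x"
  shows "sum g (\<Union>i\<in>I. W i) \<le> (\<Sum>i\<in>I. sum g (W i))"
  using assms(1)
proof induction
  case (insert i I)
  have "sum g (W i \<union> (\<Union>i\<in>I. W i)) \<le> sum g (W i) + sum g (\<Union>i\<in>I. W i)"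
    using insert assms by (simp add: sum_Un sum_nonneg)
  then show ?case using insert by simp
qed simp

text \<open>
  This is how the tree and the level set are linked: if deep alive triangles stayed outside \<open>V\<close>, a
  limit point of them would be a limit both of vertices with \<open>f < y\<close> and of vertices
  with \<open>f \<ge> y\<close>, so it would lie in the level set and hence in \<open>V\<close>.
\<close>

lemma deep_alive_near_level_set:
  fixes P :: "3 \<Rightarrow> 'a::euclidean_space" and f :: "'a \<Rightarrow> real"
  assumes diam: "\<And>i j. dist (P i) (P j) \<le> 1"
    and cont: "continuous_on (closure (vertices P)) f"
    and V: "open V" "{x \<in> closure (vertices P). f x = y} \<subseteq> V"
  shows "\<exists>N. \<forall>u. alive (\<lambda>v. f v < y) P u \<longrightarrow> N \<le> length u \<longrightarrow> (\<forall>i. vtx P u i \<in> V)"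
proof (rule ccontr)
  let ?L = "\<lambda>v. f v < y" and ?K = "closure (vertices P)"
  assume "\<not> ?thesis"
  then have "\<forall>N. \<exists>u i. alive ?L P u \<and> N \<le> length u \<and> vtx P u i \<notin> V" by blast
  then obtain u i where u: "\<And>N. alive ?L P (u N)" "\<And>N. N \<le> length (u N)"
      "\<And>N. vtx P (u N) (i N) \<notin> V" by metis
  have "\<exists>a b. ?L (vtx P (u N) a) \<and> \<not> ?L (vtx P (u N) b)" for N
    using alive_imp_mixed[OF u(1)[of N]] unfolding mixed_def by blast
  then obtain a b where ab: "\<And>N. f (vtx P (u N) (a N)) < y" "\<And>N. \<not> f (vtx P (u N) (b N)) < y"
    by metis
  let ?X = "\<lambda>j N. vtx P (u N) (j N)"
  have "seq_compact ?K" using compact_closure_vertices[OF diam]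
    by (simp add: compact_eq_seq_compact_metric)
  moreover have XK: "?X j N \<in> ?K" for j N
    using vtx_in_vertices closure_subset by blast
  ultimately obtain x \<phi> where x: "x \<in> ?K" and \<phi>: "strict_mono \<phi>" and lim: "(?X i \<circ> \<phi>) \<longlonglongrightarrow> x"
    unfolding seq_compact_def by (metis (no_types, lifting))
  have limj: "(\<lambda>k. ?X j (\<phi> k)) \<longlonglongrightarrow> x" for j
  proof -
    have "dist (?X j N) (?X i N) \<le> (1/2) ^ N" for N
    proof -
      have "dist (?X j N) (?X i N) \<le> 1 / 2 ^ length (u N)"
        using dist_vtx_hull[of P "?X j N" "u N", OF diam] by (simp add: hull_inc)
      also have "\<dots> \<le> 1 / 2 ^ N" using u(2)[of N] by (simp add: frac_le)
      finally show ?thesis by (simp add: power_one_over)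
    qed
    then have "(\<lambda>N. dist (?X j N) (?X i N)) \<longlonglongrightarrow> 0"
      by (intro tendsto_sandwich[OF _ _ tendsto_const LIMSEQ_realpow_zero[of "1/2"]]) auto
    then have "(\<lambda>k. dist (?X j (\<phi> k)) (?X i (\<phi> k))) \<longlonglongrightarrow> 0"
      using LIMSEQ_subseq_LIMSEQ[OF _ \<phi>] by (fastforce simp: o_def)
    then have "(\<lambda>k. ?X j (\<phi> k) - ?X i (\<phi> k)) \<longlonglongrightarrow> 0"
      by (simp add: dist_norm tendsto_norm_zero_iff)
    then show ?thesis using lim tendsto_add[of "\<lambda>k. ?X j (\<phi> k) - ?X i (\<phi> k)" 0 _ "?X i \<circ> \<phi>" x]
      by (simp add: o_def)
  qed
  have flim: "(\<lambda>k. f (?X j (\<phi> k))) \<longlonglongrightarrow> f x" for j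
    using cont limj[of j] XK[where j = j] x unfolding continuous_on_sequentially by (auto simp: o_def)
  have "f x \<le> y" using flim[of a] ab(1) by (intro LIMSEQ_le_const2) (auto intro: less_imp_le)
  moreover have "y \<le> f x" using flim[of b] ab(2) by (intro LIMSEQ_le_const) (auto simp: not_less)
  ultimately have "x \<in> V" using V x by auto
  then have "eventually (\<lambda>k. ?X i (\<phi> k) \<in> V) sequentially"
    using limj[of i] V(1) by (simp add: topological_tendstoD)
  then show False using u(3) by (auto simp: eventually_sequentially)
qed

text \<open>
  The mass distribution principle in finite form. Sets covering the level set are enlarged to balls
  of dyadic radius; by compactness finitely many balls remain, and they contain the vertices of all
  sufficiently deep alive triangles. The alive words of the corresponding lengths that lie near the
  centres therefore cut the tree, and their total weight, at least \<open>1\<close>, is bounded in terms of the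
  gauges of the covering sets.
\<close>

lemma level_set_measure_pos:
  fixes P :: "3 \<Rightarrow> 'a::euclidean_space" and f :: "'a \<Rightarrow> real" and \<theta> :: real
  assumes diam: "\<And>i j. dist (P i) (P j) \<le> 1" and nd: "nondegenerate P"
    and cont: "continuous_on (closure (vertices P)) f"
    and root: "mixed (\<lambda>v. f v < y) P"
    and growth: "\<And>w. alive (\<lambda>v. f v < y) P w \<Longrightarrow> N0 \<le> length w \<Longrightarrow>
                   \<theta> * length w \<le> fork_count (\<lambda>v. f v < y) P w"
    and s: "0 \<le> s" "s \<le> \<theta>" "0 < \<theta>"
  shows "0 < hausdorff_measure s {x \<in> closure (vertices P). f x = y}"
proof -
  let ?L = "\<lambda>v. f v < y" and ?K = "closure (vertices P)"
  let ?A = "{x \<in> ?K. f x = y}"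
  obtain M where M: "\<And>n x. finite {w. length w = n \<and> dist (vtx P w 1) x < 3 / 2 ^ n}"
    "\<And>n x. card {w. length w = n \<and> dist (vtx P w 1) x < 3 / 2 ^ n} \<le> M"
    using bounded_overlap[OF nd] by blast
  define D where "D = (real M + 1) * 2 powr (\<theta> * N0)"
  have D: "D > 0" unfolding D_def by (simp add: add_nonneg_pos)
  define c where "c = 1 / (2 * D * 2 powr \<theta>)"
  have "c > 0" using D by (simp add: c_def)
  have compK: "compact ?K" using diam by (rule compact_closure_vertices)
  have "compact ?A"
  proof -
    have "closed (?K \<inter> f -` {y})"
      by (rule continuous_closed_preimage[OF cont]) auto
    then have "compact (?K \<inter> (?K \<inter> f -` {y}))" by (rule compact_Int_closed[OF compK])
    moreover have "?K \<inter> (?K \<inter> f -` {y}) = ?A" by auto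
    ultimately show ?thesis by simp
  qed
  have weight: "(1/2) ^ fork_count ?L P w \<le> 2 powr (\<theta> * N0) * (1 / 2 ^ length w) powr \<theta>"
    if w: "alive ?L P w" for w
  proof -
    have "0 \<le> \<theta> * N0" using s by simp
    have "\<theta> * length w \<le> fork_count ?L P w + \<theta> * N0"
    proof (cases "N0 \<le> length w")
      case True
      then show ?thesis using growth[OF w True] \<open>0 \<le> \<theta> * N0\<close> by linarith
    next
      case False
      then have "\<theta> * length w \<le> \<theta> * N0" using s by (intro mult_left_mono) auto
      then show ?thesis by linarith
    qed
    then have "(2::real) powr (- real (fork_count ?L P w)) \<le> 2 powr (\<theta> * N0 + - (\<theta> * length w))"
      by (intro powr_mono) auto
    moreover have "(1/2::real) ^ fork_count ?L P w = 2 powr (- real (fork_count ?L P w))"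
      by (simp add: powr_minus powr_realpow power_one_over inverse_eq_divide)
    moreover have "(1 / 2 ^ length w :: real) powr \<theta> = 2 powr (- (\<theta> * length w))"
      by (simp add: powr_realpow[symmetric] powr_powr powr_divide powr_minus_divide mult.commute)
    ultimately show ?thesis by (simp only: powr_add)
  qed
  have "ennreal c \<le> (\<Sum>i. ennreal (hausdorff_gauge s (U i)))"
    if U: "?A \<subseteq> (\<Union>i. U i)" "\<And>i. bounded (U i)" "\<And>i. diameter (U i) \<le> 1"
    for U :: "nat \<Rightarrow> 'a set"
  proof -
    \<comment> \<open>The errors sum to at most \<open>1 / (2 * D)\<close>, which costs half of the total weight \<open>1\<close>.\<close>
    define \<epsilon> where "\<epsilon> i = 1 / (2 * D) * (1/2) ^ Suc i" for i
    have "\<exists>n x. U i \<noteq> {} \<longrightarrow> x \<in> U i \<and> diameter (U i) \<le> 1 / 2 ^ n \<and>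
        (1 / 2 ^ n) powr \<theta> \<le> 2 powr \<theta> * hausdorff_gauge s (U i) + \<epsilon> i" for i
    proof (cases "U i = {}")
      case False
      have "0 < \<epsilon> i" using D by (simp add: \<epsilon>_def)
      then obtain n where "diameter (U i) \<le> 1 / 2 ^ n"
          "(1 / 2 ^ n) powr \<theta> \<le> 2 powr \<theta> * diameter (U i) powr \<theta> + \<epsilon> i"
        using dyadic_scale[OF diameter_ge_0[OF U(2)] U(3) s(3)] by blast
      moreover have "2 powr \<theta> * diameter (U i) powr \<theta> \<le> 2 powr \<theta> * hausdorff_gauge s (U i)"
        using diameter_powr_le_gauge[OF False U(2) U(3) s(1,2)] by simp
      ultimately show ?thesis using False by (meson add_right_mono order_trans ex_in_conv)
    qed auto
    then obtain n x where nx: "\<And>i. U i \<noteq> {} \<Longrightarrow> x i \<in> U i" "\<And>i. U i \<noteq> {} \<Longrightarrow> diameter (U i) \<le> 1 / 2 ^ n i"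
      "\<And>i. U i \<noteq> {} \<Longrightarrow> (1 / 2 ^ n i) powr \<theta> \<le> 2 powr \<theta> * hausdorff_gauge s (U i) + \<epsilon> i"
      by metis
    \<comment> \<open>The balls contain the covering sets, with room to spare for openness.\<close>
    define V where "V i = ball (x i) (2 / 2 ^ n i)" for i
    have "U i \<subseteq> V i" if "U i \<noteq> {}" for i
    proof
      fix z assume "z \<in> U i"
      then have "dist (x i) z \<le> 1 / 2 ^ n i"
        using diameter_bounded_bound[OF U(2) nx(1)[OF that]] nx(2)[OF that] by force
      also have "\<dots> < 2 / 2 ^ n i" by (simp add: divide_strict_right_mono)
      finally show "z \<in> V i" by (simp add: V_def)
    qed
    then have "?A \<subseteq> (\<Union>i\<in>{i. U i \<noteq> {}}. V i)" using U(1) by blast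
    then obtain I where I: "I \<subseteq> {i. U i \<noteq> {}}" "finite I" "?A \<subseteq> (\<Union>i\<in>I. V i)"
      using compactE_image[OF \<open>compact ?A\<close>, of "{i. U i \<noteq> {}}" V] by (auto simp: V_def)
    have "open (\<Union>i\<in>I. V i)" by (auto simp: V_def)
    from deep_alive_near_level_set[OF diam cont this I(3)]
    obtain N where N: "\<And>u j. alive ?L P u \<Longrightarrow> N \<le> length u \<Longrightarrow> vtx P u j \<in> (\<Union>i\<in>I. V i)"
      by blast
    \<comment> \<open>Radius \<open>3 / 2 ^ n i\<close>: that of \<open>V i\<close> plus the diameter of a triangle of level \<open>n i\<close>.\<close>
    define W where "W i = {w. alive ?L P w \<and> length w = n i \<and> dist (vtx P w 1) (x i) < 3 / 2 ^ n i}" for i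
    have W: "finite (W i)" "card (W i) \<le> M" for i
    proof -
      have sub: "W i \<subseteq> {w. length w = n i \<and> dist (vtx P w 1) (x i) < 3 / 2 ^ n i}"
        unfolding W_def by blast
      show "finite (W i)" using sub M(1) by (rule finite_subset)
      show "card (W i) \<le> M" using card_mono[OF M(1) sub] M(2) by (rule order_trans)
    qed
    define F where "F = (\<Union>i\<in>I. W i)"
    have finF: "finite F" using I(2) W by (simp add: F_def)
    \<comment> \<open>Deep enough to have an ancestor of length \<open>n i\<close> for every \<open>i \<in> I\<close>.\<close>
    define N' where "N' = N + (\<Sum>i\<in>I. n i)"
    have cut: "\<exists>u\<in>F. u \<in> descendants [] \<and> z \<in> descendants u"
      if z: "alive ?L P z" "length z = N'" for z
    proof -
      obtain i where i: "i \<in> I" "vtx P z 1 \<in> V i" using N[of z 1] z by (auto simp: N'_def)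
      have "n i \<le> N'" using member_le_sum[OF i(1), of n] I(2) by (simp add: N'_def)
      define u where "u = drop (N' - n i) z"
      have len: "length u = n i" using z \<open>n i \<le> N'\<close> by (simp add: u_def)
      have zu: "z = take (N' - n i) z @ u" by (simp add: u_def)
      have "alive ?L P u" using z(1) alive_append by (metis zu)
      moreover have "dist (vtx P z 1) (vtx P u 1) \<le> 1 / 2 ^ n i"
        using dist_vtx_hull[of P "vtx P z 1" u 1, OF diam] vtx_in_hull[of "vtx P u"] len
        by (metis zu vtx_append)
      then have "dist (vtx P u 1) (x i) < 3 / 2 ^ n i"
        using i(2) dist_triangle[of "vtx P u 1" "x i" "vtx P z 1"]
        by (simp add: V_def dist_commute add_divide_distrib[symmetric])
      ultimately have "u \<in> F" using i len by (auto simp: F_def W_def)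
      then show ?thesis using zu by (auto simp: descendants_def)
    qed
    have "1 \<le> (\<Sum>u\<in>F \<inter> descendants []. (1/2::real) ^ fork_count ?L P u)"
      using cut_weight_ge[OF finF, of ?L P N' "[]" N'] cut root by (force simp: F_def W_def)
    also have "F \<inter> descendants [] = F" by (auto simp: descendants_def)
    also have "(\<Sum>u\<in>F. (1/2::real) ^ fork_count ?L P u)
        \<le> (\<Sum>i\<in>I. \<Sum>u\<in>W i. (1/2::real) ^ fork_count ?L P u)"
      unfolding F_def using I(2) W(1) by (intro sum_UN_le) auto
    also have "\<dots> \<le> (\<Sum>i\<in>I. D * (2 powr \<theta> * hausdorff_gauge s (U i) + \<epsilon> i))"
    proof (rule sum_mono)
      fix i assume i: "i \<in> I"
      have "(\<Sum>u\<in>W i. (1/2::real) ^ fork_count ?L P u)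
          \<le> (\<Sum>u\<in>W i. 2 powr (\<theta> * N0) * (1 / 2 ^ n i) powr \<theta>)"
      proof (rule sum_mono)
        fix u assume "u \<in> W i"
        then show "(1/2) ^ fork_count ?L P u \<le> 2 powr (\<theta> * N0) * (1 / 2 ^ n i) powr \<theta>"
          using weight[of u] by (simp add: W_def)
      qed
      also have "\<dots> = real (card (W i)) * (2 powr (\<theta> * N0) * (1 / 2 ^ n i) powr \<theta>)" by simp
      also have "\<dots> \<le> (real M + 1) * (2 powr (\<theta> * N0) * (1 / 2 ^ n i) powr \<theta>)"
        using W(2)[of i] by (intro mult_right_mono) auto
      also have "\<dots> = D * (1 / 2 ^ n i) powr \<theta>" by (simp add: D_def)
      also have "\<dots> \<le> D * (2 powr \<theta> * hausdorff_gauge s (U i) + \<epsilon> i)"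
        using nx(3)[of i] I(1) i D by (intro mult_left_mono) auto
      finally show "(\<Sum>u\<in>W i. (1/2::real) ^ fork_count ?L P u)
          \<le> D * (2 powr \<theta> * hausdorff_gauge s (U i) + \<epsilon> i)" .
    qed
    also have "\<dots> = D * 2 powr \<theta> * (\<Sum>i\<in>I. hausdorff_gauge s (U i)) + (\<Sum>i\<in>I. (1/2) ^ Suc i) / 2"
      using D by (simp add: \<epsilon>_def sum.distrib sum_distrib_left distrib_left mult.assoc
          sum_divide_distrib)
    finally have "1 \<le> D * 2 powr \<theta> * (\<Sum>i\<in>I. hausdorff_gauge s (U i)) + (\<Sum>i\<in>I. (1/2) ^ Suc i) / 2" .
    moreover have "(\<Sum>i\<in>I. (1/2::real) ^ Suc i) \<le> 1"
      using sum_le_suminf[of "\<lambda>i. (1/2::real) ^ Suc i" I] I(2) power_half_series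
      by (auto simp: sums_iff)
    ultimately have "1 / 2 \<le> D * 2 powr \<theta> * (\<Sum>i\<in>I. hausdorff_gauge s (U i))" by linarith
    then have "c \<le> (\<Sum>i\<in>I. hausdorff_gauge s (U i))"
      using D by (simp add: c_def field_simps)
    then have "ennreal c \<le> (\<Sum>i\<in>I. ennreal (hausdorff_gauge s (U i)))"
      by (simp add: sum_ennreal hausdorff_gauge_nonneg ennreal_leI)
    also have "\<dots> \<le> (\<Sum>i. ennreal (hausdorff_gauge s (U i)))"
      using I(2) by (intro sum_le_suminf) auto
    finally show ?thesis .
  qed
  then have "ennreal c \<le> hausdorff_premeasure s 1 ?A"
    unfolding hausdorff_premeasure_def by (intro INF_greatest) auto
  also have "\<dots> \<le> hausdorff_measure s ?A"
    unfolding hausdorff_measure_def by (intro SUP_upper) auto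
  finally show ?thesis using \<open>c > 0\<close> by (metis ennreal_less_zero_iff less_le_trans)
qed

section \<open>Almost every level has many forks\<close>

text \<open>
  Write \<open>\<theta> = \<alpha> / (2 K)\<close>, where \<open>K\<close> is the denominator in the definition of \<open>\<theta>\<close>. Taking
  logarithms and using \<open>1 + \<theta> \<le> exp \<theta>\<close> reduces the last claim to
  \<open>1 + ln (18 K / \<alpha>) < 2 K ln 2\<close>. The summand \<open>2 ln (3 / \<alpha>)\<close> of the right-hand side absorbs
  \<open>ln (1 / \<alpha>)\<close>, the tangent of the logarithm at \<open>4\<close> makes \<open>ln K\<close> linear, and crude bounds
  on \<open>ln 2\<close> and \<open>ln 3\<close> suffice for what remains.
\<close>

lemma exponent_inequality:
  fixes \<alpha> :: real
  assumes \<alpha>: "0 < \<alpha>" "\<alpha> \<le> 1"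
  defines "\<theta> \<equiv> (\<alpha> / 2) / (1 + (1 + ln (3 / \<alpha>)) / ln 2 + 2 / \<alpha>)"
  shows "0 < \<theta>" "\<theta> \<le> 1" "(1 + \<theta>) * (\<theta> / 9) powr (- \<theta>) < 2 powr \<alpha>"
proof -
  define l where "l = ln (2::real)"
  have l: "2/3 \<le> l" "l \<le> 25/36" unfolding l_def by (rule ln2_ge_two_thirds ln2_le_25_over_36)+
  define u where "u = 1 / \<alpha>"
  have u: "1 \<le> u" using \<alpha> by (simp add: u_def)
  define b where "b = ln u"
  have b: "0 \<le> b" using u by (simp add: b_def)
  define h where "h = ln (3::real)"
  have h: "0 \<le> h" "h \<le> 2 * l"
  proof -
    have "ln (3::real) \<le> ln (2 ^ 2)" by (intro ln_mono) auto
    also have "ln (2 ^ 2 :: real) = 2 * ln 2" using ln_realpow[of "2::real" 2] by simp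
    finally show "h \<le> 2 * l" by (simp add: h_def l_def)
  qed (simp add: h_def)
  define K where "K = 1 + (1 + ln (3 / \<alpha>)) / ln 2 + 2 / \<alpha>"
  have K: "K = 1 + (1 + h + b) / l + 2 * u"
    using \<alpha> by (simp add: K_def h_def b_def l_def u_def ln_div)
  have "K \<ge> 3" unfolding K using u h b l by (simp add: add_increasing)
  have Kl: "K * l = l + 1 + h + b + 2 * u * l" unfolding K using l by (simp add: field_simps)
  have \<theta>: "\<theta> = \<alpha> / (2 * K)" unfolding \<theta>_def K_def by simp
  show pos: "0 < \<theta>" using \<alpha> \<open>K \<ge> 3\<close> by (simp add: \<theta>)
  show "\<theta> \<le> 1" using \<alpha> \<open>K \<ge> 3\<close> by (simp add: \<theta> divide_le_eq)
  have lnK: "ln K \<le> 2 * l - 1 + K / 4"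
  proof -
    have "ln K = ln (K / 4) + ln (2 ^ 2)" using \<open>K \<ge> 3\<close> by (simp add: ln_div)
    also have "ln (2 ^ 2 :: real) = 2 * l" using ln_realpow[of "2::real" 2] by (simp add: l_def)
    also have "ln (K / 4) + 2 * l \<le> (K / 4 - 1) + 2 * l"
      using ln_le_minus_one[of "K / 4"] \<open>K \<ge> 3\<close> by simp
    finally show ?thesis by simp
  qed
  have "1 + l + 2 * h + b + ln K < 2 * (K * l)"
  proof -
    have "(1 + h + b) / l \<le> (1 + h + b) / (2 / 3)"
      using l h b by (intro divide_left_mono) auto
    then have "K \<le> 1 + (1 + h + b) * (3 / 2) + 2 * u" unfolding K by simp
    moreover have "u * (2/3) \<le> u * l" using u l by (intro mult_left_mono) auto
    ultimately show ?thesis using lnK l h b u unfolding Kl distrib_right by argo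
  qed
  moreover have "ln (9 / \<theta>) = 2 * h + l + ln K + b"
  proof -
    have "9 / \<theta> = 3 ^ 2 * (2 * (K * u))" using \<alpha> \<open>K \<ge> 3\<close> by (simp add: \<theta> u_def)
    also have "ln \<dots> = ln (3 ^ 2) + (l + (ln K + b))"
      using u \<open>K \<ge> 3\<close> by (subst ln_mult_pos; simp add: ln_mult_pos l_def b_def)
    also have "ln (3 ^ 2 :: real) = 2 * h" using ln_realpow[of "3::real" 2] by (simp add: h_def)
    finally show ?thesis by simp
  qed
  ultimately have "1 + ln (9 / \<theta>) < 2 * (K * l)" by simp
  then have "\<theta> * (1 + ln (9 / \<theta>)) < \<theta> * (2 * (K * l))" using pos by simp
  also have "\<theta> * (2 * (K * l)) = \<alpha> * l" using \<open>K \<ge> 3\<close> by (simp add: \<theta>)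
  finally have main: "\<theta> + \<theta> * ln (9 / \<theta>) < \<alpha> * ln 2" by (simp add: distrib_left l_def)
  have "(1 + \<theta>) * (\<theta> / 9) powr (- \<theta>) \<le> exp \<theta> * exp (\<theta> * ln (9 / \<theta>))"
    using pos exp_ge_add_one_self[of \<theta>] by (intro mult_mono) (auto simp: powr_def ln_div algebra_simps)
  also have "\<dots> < exp (\<alpha> * ln 2)" using main by (simp flip: exp_add)
  also have "\<dots> = 2 powr \<alpha>" by (simp add: powr_def)
  finally show "(1 + \<theta>) * (\<theta> / 9) powr (- \<theta>) < 2 powr \<alpha>" .
qed

text \<open>
  The set \<open>A n\<close> below contains every level \<open>y\<close> with an alive word of length \<open>n\<close> and at most
  \<open>\<theta> n\<close> forks: the word comes from a code in \<open>C n\<close>, and since its triangle is mixed, \<open>y\<close> is within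
  \<open>\<rho> n\<close> of the value of \<open>f\<close> at its first vertex. The measure of \<open>A n\<close> decays geometrically.
\<close>

lemma AE_fork_growth:
  fixes P :: "3 \<Rightarrow> 'a::real_normed_vector" and f :: "'a \<Rightarrow> real" and \<alpha> \<theta> :: real
  assumes diam: "\<And>i j. dist (P i) (P j) \<le> 1"
    and holder: "\<And>x y. x \<in> vertices P \<Longrightarrow> y \<in> vertices P \<Longrightarrow> \<bar>f x - f y\<bar> \<le> dist x y powr \<alpha>"
    and \<alpha>: "0 < \<alpha>" and \<theta>: "0 < \<theta>" "\<theta> \<le> 1"
    and small: "(1 + \<theta>) * (\<theta> / 9) powr (- \<theta>) < 2 powr \<alpha>"
  shows "AE y in lborel. \<exists>N0. \<forall>w. alive (\<lambda>v. f v < y) P w \<longrightarrow> N0 \<le> length w \<longrightarrow>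
           \<theta> * real (length w) \<le> real (fork_count (\<lambda>v. f v < y) P w)"
proof -
  define q where "q = (1 + \<theta>) * (\<theta> / 9) powr (- \<theta>)"
  define G where "G n = {xs :: (3 \<times> 3) option list. length xs = n \<and> real (jumps xs) \<le> \<theta> * n}" for n
  define C where "C n = (UNIV :: 3 set) \<times> G n" for n
  define \<rho> where "\<rho> n = (1 / 2 ^ n) powr \<alpha>" for n :: nat
  define B where "B n z = (case z of (s, xs) \<Rightarrow> cball (f (vtx P (fst (decode s xs)) 1)) (\<rho> n))" for n z
  define A where "A n = (\<Union>z\<in>C n. B n z)" for n
  have finC: "finite (C n)" for n
    unfolding C_def G_def using finite_lists_length[of n] by (auto intro: rev_finite_subset)
  have cardC: "real (card (C n)) \<le> 3 * q ^ n" for n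
    using card_few_jumps_le[of "\<theta> / 9" n \<theta>] \<theta>
    by (simp add: C_def G_def q_def card_cartesian_product)
  have q0: "0 \<le> q" using \<theta> by (simp add: q_def)
  have \<rho>0: "0 \<le> \<rho> n" for n by (simp add: \<rho>_def)
  have \<rho>_pow: "\<rho> n = (1 / 2 powr \<alpha>) ^ n" for n
    unfolding \<rho>_def by (simp add: powr_divide powr_power powr_realpow[symmetric] powr_powr
        power_one_over mult.commute)
  have Bm: "B n z \<in> sets lborel" for n z by (auto simp: B_def split: prod.split)
  have Be: "emeasure lborel (B n z) = ennreal (2 * \<rho> n)" for n z
    using \<rho>0[of n] by (auto simp: B_def cball_eq_atLeastAtMost split: prod.split)
  have Ae: "emeasure lborel (A n) \<le> ennreal (6 * (q / 2 powr \<alpha>) ^ n)" for n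
  proof -
    have "emeasure lborel (A n) \<le> (\<Sum>z\<in>C n. emeasure lborel (B n z))"
      unfolding A_def using finC Bm by (intro emeasure_subadditive_finite) auto
    also have "\<dots> = ennreal (real (card (C n)) * (2 * \<rho> n))"
      using \<rho>0[of n] by (simp add: Be ennreal_mult' ennreal_of_nat_eq_real_of_nat)
    also have "\<dots> \<le> ennreal (3 * q ^ n * (2 * \<rho> n))"
      using cardC[of n] \<rho>0[of n] by (intro ennreal_leI mult_right_mono) auto
    also have "3 * q ^ n * (2 * \<rho> n) = 6 * (q / 2 powr \<alpha>) ^ n"
      by (simp add: \<rho>_pow power_divide)
    finally show ?thesis .
  qed
  have ratio: "0 \<le> q / 2 powr \<alpha>" "q / 2 powr \<alpha> < 1" using small q0 by (auto simp: q_def)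
  have "AE y in lborel. eventually (\<lambda>n. y \<in> space lborel - A n) sequentially"
  proof (rule borel_cantelli_AE1)
    show "A n \<in> sets lborel" for n unfolding A_def using finC Bm by (intro sets.finite_UN) auto
    show "emeasure lborel (A n) < \<infinity>" for n
      using Ae[of n] by (simp add: order_le_less_trans)
    show "summable (\<lambda>n. measure lborel (A n))"
    proof (rule summable_comparison_test')
      show "summable (\<lambda>n. 6 * (q / 2 powr \<alpha>) ^ n)"
        using ratio by (intro summable_mult summable_geometric)
          (simp only: real_norm_def abs_of_nonneg)
      show "norm (measure lborel (A n)) \<le> 6 * (q / 2 powr \<alpha>) ^ n" for n
        using Ae[of n] ratio by (simp add: measure_def enn2real_leI)
    qed
  qed
  then show ?thesis
  proof (rule AE_mp, intro AE_I2 impI)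
    fix y :: real
    let ?L = "\<lambda>v. f v < y"
    assume "eventually (\<lambda>n. y \<in> space lborel - A n) sequentially"
    then obtain N0 where N0: "\<And>n. N0 \<le> n \<Longrightarrow> y \<notin> A n" by (auto simp: eventually_sequentially)
    have "\<theta> * real (length w) \<le> real (fork_count ?L P w)"
      if w: "alive ?L P w" "N0 \<le> length w" for w
    proof (rule ccontr)
      assume few: "\<not> ?thesis"
      have mx: "mixed ?L (vtx P w)" using w(1) by (rule alive_imp_mixed)
      then obtain s where "isolated ?L (vtx P w) s" using mixed_obtain_isolated by blast
      from alive_has_code[OF w(1) this] obtain s0 xs where
        xs: "length xs = length w" "jumps xs = fork_count ?L P w" "decode s0 xs = (w, s)" by blast
      have inC: "(s0, xs) \<in> C (length w)" using xs few by (simp add: C_def G_def)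
      have near: "\<bar>f (vtx P w 1) - f (vtx P w i)\<bar> \<le> \<rho> (length w)" for i
      proof -
        have "\<bar>f (vtx P w 1) - f (vtx P w i)\<bar> \<le> dist (vtx P w 1) (vtx P w i) powr \<alpha>"
          by (intro holder vtx_in_vertices)
        also have "\<dots> \<le> \<rho> (length w)" unfolding \<rho>_def
          using dist_vtx_hull[of P "vtx P w 1" w i, OF diam] \<alpha>
          by (intro powr_mono2) (auto simp: hull_inc)
        finally show ?thesis .
      qed
      obtain i j where "f (vtx P w i) < y" "y \<le> f (vtx P w j)"
        using mx unfolding mixed_def by (meson not_less)
      then have "y \<in> B (length w) (s0, xs)"
        using near[of i] near[of j] by (auto simp: B_def xs dist_real_def)
      then have "y \<in> A (length w)" using inC unfolding A_def by blast
      then show False using N0[OF w(2)] by blast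
    qed
    then show "\<exists>N0. \<forall>w. alive ?L P w \<longrightarrow> N0 \<le> length w \<longrightarrow>
           \<theta> * real (length w) \<le> real (fork_count ?L P w)" by blast
  qed
qed

section \<open>The Sierpinski triangle as the closure of the vertices\<close>

lemma sierpinski_pieces_eq:
  "sierpinski_pieces (P 1, P 2, P 3) n = {(vtx P w 1, vtx P w 2, vtx P w 3) | w. length w = n}"
proof (induction n)
  case (Suc n)
  have kids: "{(a, midpoint a b, midpoint a c), (midpoint a b, b, midpoint b c),
        (midpoint a c, midpoint b c, c)}
      = {(child T i 1, child T i 2, child T i 3) | i. True}"
    if "a = T 1" "b = T 2" "c = T 3" for a b c :: 'a and T
  proof -
    have "{(child T i 1, child T i 2, child T i 3) | i. True}
        = (\<lambda>i. (child T i 1, child T i 2, child T i 3)) ` {1, 2, 3}"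
      unfolding UNIV_3[symmetric] by auto
    then show ?thesis using that by (simp add: child_def midpoint_sym)
  qed
  have "sierpinski_pieces (P 1, P 2, P 3) (Suc n)
      = (\<Union>w\<in>{w. length w = n}. {(child (vtx P w) i 1, child (vtx P w) i 2, child (vtx P w) i 3) | i. True})"
    unfolding sierpinski_pieces.simps Suc
    by (subst kids[OF refl refl refl, symmetric]) auto
  also have "\<dots> = {(vtx P w 1, vtx P w 2, vtx P w 3) | w. length w = Suc n}"
  proof (intro equalityI subsetI)
    fix z assume "z \<in> (\<Union>w\<in>{w. length w = n}. {(child (vtx P w) i 1, child (vtx P w) i 2, child (vtx P w) i 3) | i. True})"
    then obtain w i where "length w = n" "z = (child (vtx P w) i 1, child (vtx P w) i 2, child (vtx P w) i 3)"
      by auto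
    then show "z \<in> {(vtx P w 1, vtx P w 2, vtx P w 3) | w. length w = Suc n}"
      by (intro CollectI exI[of _ "i # w"]) auto
  next
    fix z assume "z \<in> {(vtx P w 1, vtx P w 2, vtx P w 3) | w. length w = Suc n}"
    then show "z \<in> (\<Union>w\<in>{w. length w = n}. {(child (vtx P w) i 1, child (vtx P w) i 2, child (vtx P w) i 3) | i. True})"
      by (fastforce simp: length_Suc_conv)
  qed
  finally show ?case .
qed auto

lemma range_3: "range (T :: 3 \<Rightarrow> 'a) = {T 1, T 2, T 3}"
  unfolding UNIV_3 by simp

lemma sierpinski_step_eq:
  "sierpinski_step (P 1, P 2, P 3) n = (\<Union>w\<in>{w. length w = n}. convex hull (range (vtx P w)))"
  unfolding sierpinski_step_def sierpinski_pieces_eq range_3 by auto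

lemma vtx_stays: "vtx P (replicate k i @ w) i = vtx P w i"
  by (induction k) (auto simp: child_def)

text \<open>
  A vertex \<open>vtx P w i\<close> survives at all later levels, through the words that repeat \<open>i\<close>; at
  earlier levels it lies in the hull of the ancestor.
\<close>

lemma vertices_subset_sierpinski: "vertices P \<subseteq> sierpinski (P 1, P 2, P 3)"
proof -
  have "vtx P w i \<in> sierpinski_step (P 1, P 2, P 3) n" for w i n
  proof -
    let ?u = "replicate n i @ w"
    let ?v = "drop (length w) ?u"
    have "length ?v = n" by simp
    moreover have "vtx P w i \<in> convex hull (range (vtx P ?v))"
    proof -
      have "?u = take (length w) ?u @ ?v" by (simp only: append_take_drop_id)
      then have "vtx P ?u i = vtx (vtx P ?v) (take (length w) ?u) i" by (metis vtx_append)
      then show ?thesis using vtx_in_hull[of "vtx P ?v"] by (simp only: vtx_stays)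
    qed
    ultimately show ?thesis unfolding sierpinski_step_eq by blast
  qed
  then show ?thesis unfolding sierpinski_def vertices_def by auto
qed

text \<open>
  This lets the tree argument start at any triangle of the construction, with
  the closure of its vertices as the underlying set.
\<close>

lemma sierpinski_eq_closure:
  fixes P :: "3 \<Rightarrow> 'a::euclidean_space"
  assumes diam: "\<And>i j. dist (P i) (P j) \<le> 1"
  shows "sierpinski (P 1, P 2, P 3) = closure (vertices P)"
proof
  show "sierpinski (P 1, P 2, P 3) \<subseteq> closure (vertices P)"
  proof
    fix x assume x: "x \<in> sierpinski (P 1, P 2, P 3)"
    show "x \<in> closure (vertices P)" unfolding closure_approachable
    proof (intro allI impI)
      fix e :: real assume "0 < e"
      then obtain n where n: "(1/2) ^ n < e" using real_arch_pow_inv[of e "1/2"] by auto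
      obtain w where w: "length w = n" "x \<in> convex hull (range (vtx P w))"
        using x unfolding sierpinski_def sierpinski_step_eq by blast
      then have "dist (vtx P w 1) x < e"
        using dist_vtx_hull[of P x w 1, OF diam w(2)] n by (simp add: power_one_over dist_commute)
      then show "\<exists>y\<in>vertices P. dist y x < e" using vtx_in_vertices by blast
    qed
  qed
  have "closed (sierpinski_step (P 1, P 2, P 3) n)" for n
    unfolding sierpinski_step_eq
    by (intro closed_UN finite_lists_length ballI compact_imp_closed compact_convex_hull
        finite_imp_compact finite_imageI finite)
  then have "closed (sierpinski (P 1, P 2, P 3))" unfolding sierpinski_def by auto
  then show "closure (vertices P) \<subseteq> sierpinski (P 1, P 2, P 3)"
    using vertices_subset_sierpinski closure_minimal by blast
qed

lemma vertices_vtx_subset: "vertices (vtx P w) \<subseteq> vertices P"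
  unfolding vertices_def by (auto simp flip: vtx_append)

section \<open>Level sets of Hoelder functions\<close>

lemma hausdorff_measure_mono: "A \<subseteq> B \<Longrightarrow> hausdorff_measure s A \<le> hausdorff_measure s B"
  unfolding hausdorff_measure_def hausdorff_premeasure_def
  by (intro SUP_mono') (auto intro!: INF_superset_mono)

lemma equilateral_nondegenerate:
  fixes P :: "3 \<Rightarrow> 'a::real_inner"
  assumes "dist (P 1) (P 2) = 1" "dist (P 2) (P 3) = 1" "dist (P 1) (P 3) = 1"
  shows "nondegenerate P"
proof -
  define u where "u = P 2 - P 1"
  define v where "v = P 3 - P 1"
  have n: "u \<bullet> u = 1" "v \<bullet> v = 1" "(v - u) \<bullet> (v - u) = 1"
    using assms by (simp_all add: u_def v_def dist_norm norm_minus_commute norm_eq_1[symmetric])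
  then have uv: "u \<bullet> v = 1/2" by (simp add: inner_diff inner_commute)
  have "\<bar>a\<bar> + \<bar>b\<bar> \<le> 2 * norm (a *\<^sub>R u + b *\<^sub>R v)" for a b
  proof (rule power2_le_imp_le)
    have "(norm (a *\<^sub>R u + b *\<^sub>R v))\<^sup>2
        = a\<^sup>2 * (u \<bullet> u) + 2 * (a * b) * (u \<bullet> v) + b\<^sup>2 * (v \<bullet> v)"
      unfolding power2_norm_eq_inner
      by (simp only: inner_add_left inner_add_right inner_scaleR_left inner_scaleR_right
          inner_commute[of v u]) (simp add: power2_eq_square algebra_simps)
    also have "\<dots> = a\<^sup>2 + a * b + b\<^sup>2" by (simp add: n uv)
    finally have "(2 * norm (a *\<^sub>R u + b *\<^sub>R v))\<^sup>2 = 4 * (a\<^sup>2 + a * b + b\<^sup>2)"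
      by (simp add: power_mult_distrib)
    moreover have "(\<bar>a\<bar> + \<bar>b\<bar>)\<^sup>2 = a\<^sup>2 + 2 * \<bar>a * b\<bar> + b\<^sup>2" by (simp add: power2_sum abs_mult)
    moreover have "0 \<le> 3 * (\<bar>a\<bar> - \<bar>b\<bar>)\<^sup>2" by simp
    then have "0 \<le> 3 * a\<^sup>2 - 6 * \<bar>a * b\<bar> + 3 * b\<^sup>2"
      by (simp add: power2_diff abs_mult)
    moreover have "- \<bar>a * b\<bar> \<le> a * b" by simp
    ultimately show "(\<bar>a\<bar> + \<bar>b\<bar>)\<^sup>2 \<le> (2 * norm (a *\<^sub>R u + b *\<^sub>R v))\<^sup>2" by simp
  qed simp
  then show ?thesis unfolding nondegenerate_def u_def v_def by blast
qed

text \<open>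
  Each child shares its corner with its parent, so a single label spreads through
  the whole construction.
\<close>

lemma unmixed_labels_constant:
  assumes "\<And>w. \<not> mixed L (vtx P w)"
  shows "L (vtx P w i) = L (P 1)"
proof (induction w arbitrary: i)
  case Nil
  then show ?case using assms[of "[]"] unfolding mixed_def by auto
next
  case (Cons c w)
  have "L (vtx P (c # w) i) = L (vtx P (c # w) c)" using assms[of "c # w"] unfolding mixed_def by blast
  also have "vtx P (c # w) c = vtx P w c" by (simp add: child_def)
  finally show ?case using Cons by simp
qed

lemma obtain_mixed_triangle:
  fixes P :: "3 \<Rightarrow> 'a::euclidean_space" and f :: "'a \<Rightarrow> real"
  assumes cont: "continuous_on (closure (vertices P)) f"
    and x: "x \<in> closure (vertices P)" "f x < y" and x': "x' \<in> closure (vertices P)" "y < f x'"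
  obtains w where "mixed (\<lambda>v. f v < y) (vtx P w)"
proof -
  let ?L = "\<lambda>v. f v < y" and ?K = "closure (vertices P)"
  have near: "\<exists>v\<in>vertices P. f v \<in> U" if U: "open U" "z \<in> ?K" "f z \<in> U" for U z
  proof -
    obtain W where W: "open W" "W \<inter> ?K = f -` U \<inter> ?K"
      using cont U(1) unfolding continuous_on_open_invariant by blast
    have "z \<in> W" using W U by blast
    then obtain v where "v \<in> vertices P" "v \<in> W"
      using U(2) W(1) unfolding closure_iff_nhds_not_empty by blast
    then show ?thesis using W closure_subset[of "vertices P"] by blast
  qed
  obtain w i where 1: "f (vtx P w i) < y"
    using near[of "{..<y}" x] x unfolding vertices_def by auto
  obtain w' i' where 2: "y < f (vtx P w' i')"
    using near[of "{y<..}" x'] x' unfolding vertices_def by auto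
  have "\<exists>w. mixed ?L (vtx P w)"
  proof (rule ccontr)
    assume "\<not> ?thesis"
    then have "?L (vtx P w i) = ?L (vtx P w' i')" using unmixed_labels_constant[of ?L P] by blast
    then show False using 1 2 by simp
  qed
  then show thesis using that by blast
qed

theorem theorem3p2:
  fixes p q r :: "real ^ 2" and f :: "real ^ 2 \<Rightarrow> real" and \<alpha> :: real
  assumes "dist p q = 1" and "dist q r = 1" and "dist p r = 1"
    and "0 < \<alpha>" and "\<alpha> \<le> 1"
    and "holder_on 1 \<alpha> (sierpinski (p, q, r)) f"
  shows "(AE y in lebesgue. y \<in> f ` sierpinski (p, q, r) \<longrightarrow>
            hausdorff_dim {x \<in> sierpinski (p, q, r). f x = y}
              \<ge> ereal ((\<alpha> / 2) / (1 + (1 + ln (3 / \<alpha>)) / ln 2 + 2 / \<alpha>)))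
         \<and> (\<alpha> / 2) / (1 + (1 + ln (3 / \<alpha>)) / ln 2 + 2 / \<alpha>) > 0"
proof -
  define \<theta> where "\<theta> = (\<alpha> / 2) / (1 + (1 + ln (3 / \<alpha>)) / ln 2 + 2 / \<alpha>)"
  have \<theta>: "0 < \<theta>" "\<theta> \<le> 1" "(1 + \<theta>) * (\<theta> / 9) powr (- \<theta>) < 2 powr \<alpha>"
    using exponent_inequality[OF assms(4,5)] unfolding \<theta>_def by blast+
  define P :: "3 \<Rightarrow> real ^ 2" where "P i = (if i = 1 then p else if i = 2 then q else r)" for i
  have P: "P 1 = p" "P 2 = q" "P 3 = r" by (simp_all add: P_def)
  have nd: "nondegenerate P" using assms by (intro equilateral_nondegenerate) (simp_all add: P)
  have diam: "dist (P i) (P j) \<le> 1" for i j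
    using exhaust_3[of i] exhaust_3[of j] assms(1-3) by (auto simp: P dist_commute)
  define S where "S = sierpinski (p, q, r)"
  have S: "S = closure (vertices P)"
    using sierpinski_eq_closure[of P, OF diam] by (simp add: S_def P)
  have holder: "\<bar>f x - f y\<bar> \<le> dist x y powr \<alpha>" if "x \<in> S" "y \<in> S" for x y
    using assms(6) that unfolding holder_on_def S_def by (simp add: dist_norm)
  have cont: "continuous_on S f" unfolding continuous_on_iff
  proof (intro ballI allI impI)
    fix x e assume x: "x \<in> S" and e: "0 < (e::real)"
    show "\<exists>d>0. \<forall>x'\<in>S. dist x' x < d \<longrightarrow> dist (f x') (f x) < e"
    proof (intro exI[of _ "e powr (1 / \<alpha>)"] conjI ballI impI)
      fix x' assume "x' \<in> S" "dist x' x < e powr (1 / \<alpha>)"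
      then have "dist x' x powr \<alpha> < (e powr (1 / \<alpha>)) powr \<alpha>"
        using assms(4) by (intro powr_less_mono2) auto
      also have "\<dots> = e" using e assms(4) by (simp add: powr_powr)
      finally show "dist (f x') (f x) < e"
        using holder[OF \<open>x' \<in> S\<close> x] by (simp add: dist_real_def)
    qed (use e in simp)
  qed
  have sub: "vertices (vtx P v) \<subseteq> S" "closure (vertices (vtx P v)) \<subseteq> S" for v
    unfolding S using vertices_vtx_subset closure_subset closure_mono by blast+
  have small: "dist (vtx P v i) (vtx P v j) \<le> 1" for v i j
  proof -
    have "dist (vtx P v i) (vtx P v j) \<le> 1 / 2 ^ length v"
      by (intro dist_vtx_hull diam) (simp add: hull_inc)
    also have "\<dots> \<le> 1" by simp
    finally show ?thesis .
  qed
  have growth: "AE y in lborel. \<forall>v. \<exists>N0. \<forall>w. alive (\<lambda>x. f x < y) (vtx P v) w \<longrightarrow> N0 \<le> length w \<longrightarrow>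
           \<theta> * real (length w) \<le> real (fork_count (\<lambda>x. f x < y) (vtx P v) w)"
    unfolding AE_all_countable
  proof
    fix v
    have "\<bar>f x - f y\<bar> \<le> dist x y powr \<alpha>" if "x \<in> vertices (vtx P v)" "y \<in> vertices (vtx P v)" for x y
      using that sub(1) holder by blast
    from AE_fork_growth[of "vtx P v", OF small this assms(4) \<theta>]
    show "AE y in lborel. \<exists>N0. \<forall>w. alive (\<lambda>x. f x < y) (vtx P v) w \<longrightarrow> N0 \<le> length w \<longrightarrow>
           \<theta> * real (length w) \<le> real (fork_count (\<lambda>x. f x < y) (vtx P v) w)" .
  qed
  \<comment> \<open>A level strictly between the extreme values has points of the triangle on both sides.\<close>
  have extreme: "AE y in lborel. y \<noteq> Sup (f ` S) \<and> y \<noteq> Inf (f ` S)"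
    by (intro AE_conjI AE_lborel_singleton)
  have "AE y in lborel. y \<in> f ` S \<longrightarrow> ereal \<theta> \<le> hausdorff_dim {x \<in> S. f x = y}"
    using growth extreme
  proof (rule AE_mp[OF AE_conjI], intro AE_I2 impI)
    fix y assume y: "(\<forall>v. \<exists>N0. \<forall>w. alive (\<lambda>x. f x < y) (vtx P v) w \<longrightarrow> N0 \<le> length w \<longrightarrow>
           \<theta> * real (length w) \<le> real (fork_count (\<lambda>x. f x < y) (vtx P v) w)) \<and>
           (y \<noteq> Sup (f ` S) \<and> y \<noteq> Inf (f ` S))" and yS: "y \<in> f ` S"
    obtain x where x: "x \<in> S" "f x < y"
      using y yS cInf_eq_minimum[of y "f ` S"] by (force simp: not_le[symmetric])
    obtain x' where x': "x' \<in> S" "y < f x'"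
      using y yS cSup_eq_maximum[of y "f ` S"] by (force simp: not_le[symmetric])
    obtain v where v: "mixed (\<lambda>x. f x < y) (vtx P v)"
      using obtain_mixed_triangle[OF cont[unfolded S]] x x' unfolding S by blast
    obtain N0 where N0: "\<And>w. alive (\<lambda>x. f x < y) (vtx P v) w \<Longrightarrow> N0 \<le> length w \<Longrightarrow>
           \<theta> * real (length w) \<le> real (fork_count (\<lambda>x. f x < y) (vtx P v) w)"
      using y by blast
    have "ereal \<theta> \<le> ereal s" if s: "0 \<le> s" "hausdorff_measure s {x \<in> S. f x = y} = 0" for s
    proof (rule ccontr)
      assume "\<not> ?thesis"
      then have "s \<le> \<theta>" by simp
      have "0 < hausdorff_measure s {x \<in> closure (vertices (vtx P v)). f x = y}"
        by (rule level_set_measure_pos[OF small nondegenerate_vtx[OF nd]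
            continuous_on_subset[OF cont sub(2)] v N0 s(1) \<open>s \<le> \<theta>\<close> \<theta>(1)])
      also have "\<dots> \<le> hausdorff_measure s {x \<in> S. f x = y}"
        using sub(2) by (intro hausdorff_measure_mono) auto
      finally show False using s(2) by simp
    qed
    then show "ereal \<theta> \<le> hausdorff_dim {x \<in> S. f x = y}"
      unfolding hausdorff_dim_def by (intro Inf_greatest) auto
  qed
  then have "AE y in lebesgue. y \<in> f ` S \<longrightarrow> ereal \<theta> \<le> hausdorff_dim {x \<in> S. f x = y}"
    by (rule AE_completion)
  then show ?thesis using \<theta>(1) unfolding S_def \<theta>_def by blast
qed

end
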